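(* Let $a\ge -1$ be an integer and let $\rho'$ be the root of the polynomial $x^3-ax^2-(a+3)x-1$ satisfying $-2<\rho'<-1$. Then the (inhomogeneous) Jacobi--Perron expansion of the vector $(-\rho',\rho'^2)$ is periodic.
   Context: The polynomial $x^3-ax^2-(a+3)x-1$ (defining Shanks' simplest cubic fields) has three real roots $\rho>a+1$, $-2<\rho'<-1$, $-1<\rho''<0$. The inhomogeneous Jacobi--Perron expansion (iJPA expansion) of $\boldsymbol{\alpha}^{(0)}=(\alpha_1^{(0)},\alpha_2^{(0)})\in\mathbb{R}^2$ is the sequence $\boldsymbol{\alpha}^{(k)}$, $k\ge 0$, defined by $$\boldsymbol{\alpha}^{(k+1)}=\left(\frac{\alpha_2^{(k)}-a_2^{(k)}}{\alpha_1^{(k)}-a_1^{(k)}},\ \frac{1}{\alpha_1^{(k)}-a_1^{(k)}}\right),\qquad a_i^{(k)}=\lfloor\alpha_i^{(k)}\rfloor,\ \alpha_1^{(k)}\neq a_1^{(k)}.$$ It is periodic if there are integers $l_0\ge 0$, $l_1\ge 1$ with $\boldsymbol{\alpha}^{(k+l_1)}=\boldsymbol{\alpha}^{(k)}$ for all $k\ge l_0$. *)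

theory Defs
  imports Complex_Main "HOL-Computational_Algebra.Polynomial"
begin

definition shanks_poly :: "int \<Rightarrow> real poly" where
  "shanks_poly a = [: - 1, - (of_int a + 3), - of_int a, 1 :]"

definition iJPA_step :: "real \<times> real \<Rightarrow> real \<times> real" where
  "iJPA_step = (\<lambda>(x, y).
     ((y - of_int \<lfloor>y\<rfloor>) / (x - of_int \<lfloor>x\<rfloor>), 1 / (x - of_int \<lfloor>x\<rfloor>)))"

definition iJPA :: "real \<times> real \<Rightarrow> nat \<Rightarrow> real \<times> real" where
  "iJPA \<alpha> k = (iJPA_step ^^ k) \<alpha>"

(* The side condition of the recursion holds at every index. Division by zero is
   total in HOL, so without it a terminating expansion would continue with junk values. *)
definition iJPA_infinite :: "real \<times> real \<Rightarrow> bool" where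
  "iJPA_infinite \<alpha> \<longleftrightarrow>
     (\<forall>k. fst (iJPA \<alpha> k) \<noteq> of_int \<lfloor>fst (iJPA \<alpha> k)\<rfloor>)"

definition iJPA_periodic :: "real \<times> real \<Rightarrow> bool" where
  "iJPA_periodic \<alpha> \<longleftrightarrow> iJPA_infinite \<alpha> \<and>
     (\<exists>l0 l1. l1 \<ge> 1 \<and> (\<forall>k\<ge>l0. iJPA \<alpha> (k + l1) = iJPA \<alpha> k))"

end

theory Submission
  imports Defs
begin

text \<open>
  Put \<open>t = - \<rho>'\<close> and \<open>v = 1 / t\<close>. Since \<open>x \<mapsto> - 1 / (1 + x)\<close> permutes the roots of the polynomial,
  \<open>r = 1 / (t - 1)\<close> is the largest root, and the cubic equation becomes \<open>r = a + 1 + t - v\<close>. This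
  determines all integer parts: from \<open>(t + 1, r)\<close> the expansion runs into the cycle
  \<open>(1 + v, r), (t\<^sup>2 - 1, t), (1 / (t + 1), 1 / (t\<^sup>2 - 1)), \<dots>, (t, r + 1)\<close>,
  whose middle part depends on \<open>\<lfloor>a / 2\<rfloor>\<close> when \<open>a \<ge> 4\<close> and is shorter when \<open>1 \<le> a \<le> 3\<close>.
  The values \<open>a = - 1\<close> and \<open>a = 0\<close>, where \<open>t\<^sup>2 > 2\<close>, have cycles of their own.
\<close>

section \<open>Periodicity from a cycle of proper steps\<close>

text \<open>Bundling the side condition with the step lets \<open>rtranclp\<close> and
  \<open>tranclp\<close> chain steps while certifying that none of them divides by zero.\<close>

definition iJPA_rel :: "real \<times> real \<Rightarrow> real \<times> real \<Rightarrow> bool" where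
  "iJPA_rel p q \<longleftrightarrow> fst p \<noteq> of_int \<lfloor>fst p\<rfloor> \<and> iJPA_step p = q"

text \<open>The bounds pin both integer parts, and the strict lower one for \<open>x\<close>
  excludes an integer. The new point is characterised by products, so no quotient has to be
  simplified.\<close>

lemma iJPA_relI:
  fixes m n :: int
  assumes "of_int m < x" "x < of_int m + 1" "of_int n \<le> y" "y < of_int n + 1"
    and "x' * (x - of_int m) = y - of_int n" "y' * (x - of_int m) = 1"
  shows "iJPA_rel (x, y) (x', y')"
proof -
  have "\<lfloor>x\<rfloor> = m" "\<lfloor>y\<rfloor> = n"
    using assms by (auto intro: floor_unique)
  then show ?thesis
    using assms by (auto simp: iJPA_rel_def iJPA_step_def eq_divide_eq divide_eq_eq)
qed

lemma iJPA_rel_relpowp: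
  assumes "(iJPA_rel ^^ n) p q"
  shows "iJPA p n = q \<and> (\<forall>k<n. fst (iJPA p k) \<noteq> of_int \<lfloor>fst (iJPA p k)\<rfloor>)"
  using assms
proof (induction n arbitrary: q)
  case 0
  then show ?case by (simp add: iJPA_def)
next
  case (Suc n)
  from Suc.prems obtain s where s: "(iJPA_rel ^^ n) p s" "iJPA_rel s q" by auto
  then have "iJPA p n = s" and "\<forall>k<n. fst (iJPA p k) \<noteq> of_int \<lfloor>fst (iJPA p k)\<rfloor>"
    using Suc.IH by auto
  with s(2) show ?case by (auto simp: iJPA_def iJPA_rel_def less_Suc_eq)
qed

lemma iJPA_add: "iJPA p (k + n) = iJPA (iJPA p n) k"
  by (simp add: iJPA_def funpow_add)

text \<open>Beyond the pre-period, indices reduce modulo the cycle length, so the side condition at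
  every index follows from finitely many proper steps.\<close>

lemma iJPA_periodicI:
  assumes "iJPA_rel\<^sup>*\<^sup>* p q" "iJPA_rel\<^sup>+\<^sup>+ q q"
  shows "iJPA_periodic p"
proof -
  obtain m where m: "(iJPA_rel ^^ m) p q"
    using assms(1) rtranclp_imp_relpowp by fast
  obtain n where n: "n > 0" "(iJPA_rel ^^ n) q q"
    using assms(2) by (auto simp: tranclp_power)
  note pre = iJPA_rel_relpowp[OF m] and cyc = iJPA_rel_relpowp[OF n(2)]
  have mult: "iJPA q (n * j) = q" for j
    by (induction j) (use cyc in \<open>simp_all add: iJPA_add iJPA_def funpow_add\<close>)
  have red: "iJPA q k = iJPA q (k mod n)" for k
    using iJPA_add[of q "k mod n" "n * (k div n)"] mult by (simp add: add.commute)
  have "fst (iJPA p k) \<noteq> of_int \<lfloor>fst (iJPA p k)\<rfloor>" for k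
  proof (cases "k < m")
    case False
    then have "iJPA p k = iJPA q ((k - m) mod n)"
      using iJPA_add[of p "k - m" m] pre red by simp
    with cyc n(1) show ?thesis by simp
  qed (use pre in blast)
  moreover have "iJPA p (k + n) = iJPA p k" if "k \<ge> m" for k
    using that iJPA_add[of p "k - m" m] iJPA_add[of p "k - m + n" m]
      iJPA_add[of q "k - m" n] pre cyc by simp
  ultimately show ?thesis
    unfolding iJPA_periodic_def iJPA_infinite_def using n(1)
    by (metis One_nat_def Suc_leI)
qed

section \<open>The expansions\<close>

context
  fixes a :: int and t r v :: real
  assumes t: "1 < t" "t < 2"
    and v: "t * v = 1"
    and r: "(t - 1) * r = 1"
    and cubic: "r = of_int a + 1 + t - v"
begin

section \<open>Identities and bounds for \<open>t\<close>, \<open>v\<close>,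
  \<open>r\<close>\<close>

lemma v_bounds: "1 / 2 < v" "v < 1"
proof -
  have v_eq: "v = 1 / t" using v t by (simp add: eq_divide_eq mult.commute)
  show "1 / 2 < v" "v < 1" unfolding v_eq using t by (simp_all add: field_simps)
qed

lemma t_minus_v: "t - v = (t - 1) * (1 + v)"
  using v by (simp add: algebra_simps)

text \<open>Both factors are quotients of \<open>t\<close> and \<open>t - 1\<close>. A first
  coordinate with fractional part \<open>1 - v\<close> thus leads to second coordinate
  \<open>r + 1\<close>; this is how the cycles reach \<open>(t, r + 1)\<close>.\<close>

lemma r_plus_1_mult: "(r + 1) * (1 - v) = 1"
proof -
  have "r + 1 = r * t" using r by (simp add: algebra_simps)
  then have "(r + 1) * (1 - v) = r * (t - t * v)" by (simp add: algebra_simps)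
  then show ?thesis using v r by (simp add: mult.commute)
qed

lemma r_gt_1: "1 < r"
proof -
  have r_eq: "r = 1 / (t - 1)" using r t by (simp add: eq_divide_eq mult.commute)
  show ?thesis unfolding r_eq using t by (simp add: field_simps)
qed

text \<open>Otherwise \<open>r \<ge> 2\<close> forces \<open>t \<le> 3 / 2\<close>, and
  \<open>v > 1 / 2\<close> contradicts \<open>t - v \<ge> 1\<close>. Since \<open>v < t\<close>, the
  integer part of \<open>r\<close> is then \<open>a + 1\<close>. For \<open>a = - 1\<close> the
  bound fails, as \<open>r > 1\<close>.\<close>

lemma r_less:
  assumes "a \<ge> 0"
  shows "r < of_int a + 2"
proof (rule ccontr)
  assume "\<not> ?thesis"
  then have "t - v \<ge> 1" "r \<ge> 2" using cubic assms by auto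
  have "2 * t \<le> 3"
    using mult_left_mono[OF \<open>r \<ge> 2\<close>, of "t - 1"] r t by simp
  with \<open>t - v \<ge> 1\<close> v_bounds show False by linarith
qed

lemma square_less_2:
  assumes "a \<ge> 1"
  shows "t\<^sup>2 < 2"
proof (rule ccontr)
  assume "\<not> ?thesis"
  then have t2: "2 \<le> t * t" by (simp add: power2_eq_square)
  \<comment> \<open>\<open>7 / 5\<close> lies just below the square root of 2, and
    \<open>t = 7 / 5\<close> would give exactly \<open>r = 5 / 2\<close>.\<close>
  have "7 / 5 < t"
  proof (rule ccontr)
    assume "\<not> ?thesis"
    then have "t * t \<le> (7 / 5) * (7 / 5)" using t by (intro mult_mono) auto
    with t2 show False by simp
  qed
  moreover have "2 * v \<le> t"
    using mult_right_mono[OF t2, of v] v v_bounds by (simp add: mult.assoc)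
  ultimately have "r \<ge> 5 / 2" using cubic assms by simp
  then have "(t - 1) * (5 / 2) \<le> 1"
    using mult_left_mono[of "5 / 2" r "t - 1"] r t by simp
  with \<open>7 / 5 < t\<close> show False by simp
qed

lemma iJPA_rel_tail:
  assumes "a \<ge> 0"
  shows "iJPA_rel (t, r + 1) (1 + v, r)"
proof (rule iJPA_relI[where m = 1 and n = "a + 2"])
  show "(1 + v) * (t - of_int 1) = r + 1 - of_int (a + 2)"
    using t_minus_v cubic by (simp add: mult.commute)
qed (use t r r_less[OF assms] cubic v_bounds in \<open>simp_all add: mult.commute\<close>)

lemma iJPA_rel_one_plus_inverse:
  assumes "a \<ge> 0"
  shows "iJPA_rel (1 + v, r) (t\<^sup>2 - 1, t)"
proof (rule iJPA_relI[where m = 1 and n = "a + 1"])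
  have "(t\<^sup>2 - 1) * v = t * (t * v) - v" by (simp add: algebra_simps power2_eq_square)
  then show "(t\<^sup>2 - 1) * (1 + v - of_int 1) = r - of_int (a + 1)"
    using v cubic by simp
qed (use t v r_less[OF assms] cubic v_bounds in simp_all)

section \<open>The exceptional values \<open>a = - 1\<close> and \<open>a = 0\<close>\<close>

lemma iJPA_periodic_minus_one:
  assumes "a = - 1"
  shows "iJPA_periodic (t, t\<^sup>2)"
proof -
  have r_eq: "r = t - v" using cubic assms by simp
  have "(t - 1) * (t - v) = t\<^sup>2 - t - 1 + v"
    using v by (simp add: algebra_simps power2_eq_square)
  then have t2: "t\<^sup>2 = t + 2 - v" using r r_eq by simp
  have "v * t\<^sup>2 = v * t + 2 * v - v\<^sup>2"
    unfolding t2 by (simp add: algebra_simps power2_eq_square)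
  moreover have "v * t\<^sup>2 = (t * v) * t"
    by (simp add: power2_eq_square)
  ultimately have v2: "v\<^sup>2 = 1 + 2 * v - t"
    using v by (simp add: mult.commute)
  have "v\<^sup>2 * t = v" using v by (simp add: power2_eq_square mult.commute mult.left_commute)
  \<comment> \<open>As \<open>t\<^sup>2 = r + 2\<close>, the number \<open>t\<^sup>2 - 3\<close> is
    the fractional part of both \<open>t\<^sup>2\<close> and \<open>r\<close>; this identity serves
    all three steps.\<close>
  then have x1: "v\<^sup>2 * (t - 1) = t\<^sup>2 - 3"
    using v2 t2 by (simp add: right_diff_distrib)
  have v2_bounds: "0 < v\<^sup>2" "v\<^sup>2 < 1"
    using v_bounds by (simp_all add: power_less_one_iff)
  have t2_bounds: "3 \<le> t\<^sup>2" "t\<^sup>2 < 4"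
    using t2 t r_eq r_gt_1 v_bounds by simp_all
  have 1: "iJPA_rel (t, t\<^sup>2) (v\<^sup>2, r)"
    by (rule iJPA_relI[where m = 1 and n = 3])
      (use t t2_bounds x1 r in \<open>simp_all add: mult.commute\<close>)
  have 2: "iJPA_rel (v\<^sup>2, r) (t - 1, t\<^sup>2)"
  proof (rule iJPA_relI[where m = 0 and n = 1])
    have "t\<^sup>2 * v\<^sup>2 = (t * v)\<^sup>2" by (simp add: power_mult_distrib)
    then show "t\<^sup>2 * (v\<^sup>2 - of_int 0) = 1" using v by simp
  qed (use t v2_bounds x1 t2 r_eq r_gt_1 v_bounds in \<open>simp_all add: mult.commute\<close>)
  \<comment> \<open>Same fractional parts as at the starting point, hence the same successor: the
    cycle has length 2.\<close>
  have 3: "iJPA_rel (t - 1, t\<^sup>2) (v\<^sup>2, r)"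
    by (rule iJPA_relI[where m = 0 and n = 3])
      (use t t2_bounds x1 r in \<open>simp_all add: mult.commute\<close>)
  show ?thesis
    by (rule iJPA_periodicI[of _ "(v\<^sup>2, r)"]) (use 1 2 3 in auto)
qed

lemma iJPA_periodic_zero:
  assumes "a = 0"
  shows "iJPA_periodic (t, t\<^sup>2)"
proof -
  have r_eq: "r = 1 + t - v" using cubic assms by simp
  have "(t - 1) * (1 + t - v) = t\<^sup>2 - 2 + v"
    using v by (simp add: algebra_simps power2_eq_square)
  \<comment> \<open>The fractional part of \<open>t\<^sup>2\<close> is therefore
    \<open>1 - v\<close>, which sends \<open>(t\<^sup>2 - 1, t)\<close> straight to
    \<open>(t, r + 1)\<close>.\<close>
  then have t2: "t\<^sup>2 = 3 - v" using r r_eq by simp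
  have 1: "iJPA_rel (t, t\<^sup>2) (v, r)"
  proof (rule iJPA_relI[where m = 1 and n = 2])
    show "v * (t - of_int 1) = t\<^sup>2 - of_int 2" using t2 v by (simp add: algebra_simps)
  qed (use t t2 v r v_bounds in \<open>simp_all add: mult.commute\<close>)
  have 2: "iJPA_rel (v, r) (t\<^sup>2 - 1, t)"
  proof (rule iJPA_relI[where m = 0 and n = 1])
    have "(t\<^sup>2 - 1) * v = t * (t * v) - v" by (simp add: algebra_simps power2_eq_square)
    then show "(t\<^sup>2 - 1) * (v - of_int 0) = r - of_int 1" using v r_eq by simp
  qed (use v v_bounds r_gt_1 r_less assms in simp_all)
  have 3: "iJPA_rel (t\<^sup>2 - 1, t) (t, r + 1)"
  proof (rule iJPA_relI[where m = 1 and n = 1])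
    show "t * (t\<^sup>2 - 1 - of_int 1) = t - of_int 1" using t2 v by (simp add: right_diff_distrib)
    show "(r + 1) * (t\<^sup>2 - 1 - of_int 1) = 1"
      using r_plus_1_mult t2 by simp
  qed (use t t2 v_bounds in simp_all)
  show ?thesis
    by (rule iJPA_periodicI[of _ "(t\<^sup>2 - 1, t)"])
      (use 1 2 3 iJPA_rel_tail iJPA_rel_one_plus_inverse assms in
        \<open>force intro: rtranclp.rtrancl_into_rtrancl tranclp.trancl_into_trancl\<close>)+
qed

section \<open>The cycle for \<open>a \<ge> 1\<close>\<close>

lemma iJPA_periodic_if_return:
  assumes a: "a \<ge> 1"
    and return: "iJPA_rel\<^sup>*\<^sup>* (1 / (t + 1), 1 / (t\<^sup>2 - 1)) (t, r + 1)"
  shows "iJPA_periodic (t, t\<^sup>2)"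
proof -
  have t2: "1 < t\<^sup>2" "t\<^sup>2 < 2"
    using t square_less_2[OF a] by simp_all
  have "iJPA_rel (t, t\<^sup>2) (t + 1, r)"
    by (rule iJPA_relI[where m = 1 and n = 1])
      (use t t2 r in \<open>simp_all add: algebra_simps power2_eq_square\<close>)
  moreover have "iJPA_rel (t + 1, r) (1 + v, r)"
  proof (rule iJPA_relI[where m = 2 and n = "a + 1"])
    show "(1 + v) * (t + 1 - of_int 2) = r - of_int (a + 1)"
      using t_minus_v cubic by (simp add: mult.commute)
  qed (use t v_bounds r r_less a cubic in \<open>simp_all add: mult.commute\<close>)
  ultimately have pre: "iJPA_rel\<^sup>*\<^sup>* (t, t\<^sup>2) (1 + v, r)" by auto
  have "iJPA_rel (1 + v, r) (t\<^sup>2 - 1, t)"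
    using a by (simp add: iJPA_rel_one_plus_inverse)
  moreover have "iJPA_rel (t\<^sup>2 - 1, t) (1 / (t + 1), 1 / (t\<^sup>2 - 1))"
    by (rule iJPA_relI[where m = 0 and n = 1])
      (use t t2 in \<open>simp_all add: field_simps power2_eq_square\<close>)
  ultimately have "iJPA_rel\<^sup>+\<^sup>+ (1 + v, r) (1 / (t + 1), 1 / (t\<^sup>2 - 1))" by auto
  with return have "iJPA_rel\<^sup>+\<^sup>+ (1 + v, r) (t, r + 1)" by simp
  moreover have "iJPA_rel (t, r + 1) (1 + v, r)"
    using a by (simp add: iJPA_rel_tail)
  ultimately have "iJPA_rel\<^sup>+\<^sup>+ (1 + v, r) (1 + v, r)" by auto
  with pre show ?thesis by (rule iJPA_periodicI)
qed

text \<open>Factor \<open>t\<^sup>2 - 1\<close>. The two coordinates of the point following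
  \<open>(t\<^sup>2 - 1, t)\<close> thus have ratio \<open>r\<close>.\<close>

lemma inverse_square_minus_1: "1 / (t\<^sup>2 - 1) = r / (t + 1)"
proof -
  have "(t\<^sup>2 - 1) * r = (t + 1) * ((t - 1) * r)"
    by (simp add: algebra_simps power2_eq_square)
  then have "(t\<^sup>2 - 1) * r = t + 1" using r by simp
  moreover have "t\<^sup>2 - 1 \<noteq> 0" using t by (simp add: power2_eq_1_iff)
  ultimately show ?thesis using t by (simp add: field_simps)
qed

lemma a_mult_less_1: "of_int a * (t - 1) < 1"
proof -
  have "of_int a < r" using cubic t v_bounds by simp
  then have "(t - 1) * of_int a < (t - 1) * r" using t by (intro mult_strict_left_mono) auto
  then show ?thesis using r by (simp add: mult.commute)
qed

text \<open>Here \<open>b\<close> is the integer part of \<open>r / (t + 1)\<close>, the only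
  quantity in this step that varies with \<open>a\<close>.\<close>

lemma iJPA_rel_inverse_t_plus_1:
  fixes b :: int
  assumes "of_int b * (t + 1) \<le> r" "r < (of_int b + 1) * (t + 1)"
  shows "iJPA_rel (1 / (t + 1), 1 / (t\<^sup>2 - 1)) (r - of_int b * (t + 1), t + 1)"
  unfolding inverse_square_minus_1
  by (rule iJPA_relI[where m = 0 and n = b]) (use t assms in \<open>simp_all add: field_simps\<close>)

lemma iJPA_periodic_1_to_3:
  assumes "1 \<le> a" "a \<le> 3"
  shows "iJPA_periodic (t, t\<^sup>2)"
proof (rule iJPA_periodic_if_return)
  \<comment> \<open>Positivity gives \<open>t + v > 2\<close>, so \<open>r < 2 * (t + 1)\<close>
    holds up to \<open>a = 3\<close> and \<open>b = 1\<close> is the right integer part.\<close>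
  have tv: "(t - 1) * (1 - v) = t + v - 2" using v by (simp add: algebra_simps)
  have "0 < (t - 1) * (1 - v)" using t v_bounds by simp
  then have "iJPA_rel (1 / (t + 1), 1 / (t\<^sup>2 - 1)) (r - of_int 1 * (t + 1), t + 1)"
    by (intro iJPA_rel_inverse_t_plus_1) (use t assms v_bounds cubic tv in \<open>simp_all add: algebra_simps\<close>)
  moreover have "iJPA_rel (r - of_int 1 * (t + 1), t + 1) (t, r + 1)"
  proof (rule iJPA_relI[where m = "a - 1" and n = 2])
    have eq: "r - of_int 1 * (t + 1) - of_int (a - 1) = 1 - v" using cubic by simp
    show "t * (r - of_int 1 * (t + 1) - of_int (a - 1)) = t + 1 - of_int 2"
      unfolding eq using v by (simp add: algebra_simps)
    show "(r + 1) * (r - of_int 1 * (t + 1) - of_int (a - 1)) = 1"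
      unfolding eq by (rule r_plus_1_mult)
  qed (use t v_bounds cubic in simp_all)
  ultimately show "iJPA_rel\<^sup>*\<^sup>* (1 / (t + 1), 1 / (t\<^sup>2 - 1)) (t, r + 1)" by auto
qed fact

lemma iJPA_periodic_ge_4:
  assumes "a \<ge> 4"
  shows "iJPA_periodic (t, t\<^sup>2)"
proof (rule iJPA_periodic_if_return)
  \<comment> \<open>For large \<open>a\<close>, \<open>t\<close> is close to 1, so
    \<open>r / (t + 1)\<close> has integer part \<open>b\<close>, and the parity \<open>c\<close>
    becomes the integer part of \<open>r - b * (t + 1)\<close>.\<close>
  define b c where "b = a div 2" and "c = a mod 2"
  have a_eq: "a = 2 * b + c" by (simp add: b_def c_def)
  have c: "0 \<le> c" "c \<le> 1" and b: "2 \<le> b" using assms by (auto simp: b_def c_def)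
  define B where "B = (of_int b :: real)"
  define C where "C = (of_int c :: real)"
  have a_real: "of_int a = 2 * B + C" by (simp add: a_eq B_def C_def)
  have BC: "2 \<le> B" "0 \<le> C" "C \<le> 1" using b c by (simp_all add: B_def C_def)
  define u where "u = t - 1"
  have u: "0 < u" "u < 1 / 4" "2 * (B * u) < 1"
  proof -
    have "0 \<le> C * u" using BC t by (simp add: u_def)
    then show "2 * (B * u) < 1"
      using a_mult_less_1 by (simp add: a_real u_def algebra_simps)
    moreover have "2 * u \<le> B * u" using BC t by (intro mult_right_mono) (auto simp: u_def)
    ultimately show "u < 1 / 4" by simp
  qed (use t in \<open>simp add: u_def\<close>)
  have uv: "u < u * (1 + v)" "u * (1 + v) < 2 * u" using u v_bounds by simp_all
  have Bu: "2 * u \<le> B * u" using BC u by (intro mult_right_mono) auto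
  have r_eq: "r = 2 * B + C + 1 + u * (1 + v)"
    using cubic t_minus_v by (simp add: a_real u_def)
  \<comment> \<open>\<open>D\<close> is the fractional part of \<open>r - b * (t + 1)\<close>. The
    bounds \<open>u < D\<close> and \<open>1 / 2 < D < 1\<close> give \<open>u / D\<close> and
    \<open>1 / D\<close> integer parts 0 and 1.\<close>
  define D where "D = 1 + u * (1 + v) - B * u"
  have D: "u < D" "D < 1" "1 / 2 < D" using u uv Bu unfolding D_def by linarith+
  have D_eq: "r - of_int b * (t + 1) - C = D"
    by (simp add: r_eq D_def u_def flip: B_def) (simp add: algebra_simps)
  have ru: "r * u = 1" using r by (simp add: u_def mult.commute)
  have "iJPA_rel (1 / (t + 1), 1 / (t\<^sup>2 - 1)) (r - of_int b * (t + 1), t + 1)"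
  proof (rule iJPA_rel_inverse_t_plus_1)
    show "of_int b * (t + 1) \<le> r" using D_eq D u BC by linarith
    have "D + C < t + 1" using D BC t by simp
    then show "r < (of_int b + 1) * (t + 1)" using D_eq by (simp add: algebra_simps)
  qed
  moreover have "iJPA_rel (r - of_int b * (t + 1), t + 1) (u / D, 1 / D)"
    by (rule iJPA_relI[where m = c and n = 2])
      (use t u D D_eq in \<open>simp_all add: C_def[symmetric] u_def\<close>)
  moreover have "iJPA_rel (u / D, 1 / D) (r * (1 - D), r * D)"
    by (rule iJPA_relI[where m = 0 and n = 1])
      (use u D ru in \<open>simp_all add: field_simps\<close>)
  moreover have "iJPA_rel (r * (1 - D), r * D) (t, r + 1)"
  \<comment> \<open>Because \<open>r * u = 1\<close>, the coordinates are \<open>B - 1 - v\<close>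
    and \<open>2 + B + C + t\<close>, with integer parts \<open>b - 2\<close> and
    \<open>b + c + 3 = a - b + 3\<close>.\<close>
  proof (rule iJPA_relI[where m = "b - 2" and n = "a - b + 3"])
    have "1 - D = u * (B - 1 - v)" by (simp add: D_def algebra_simps)
    then have "r * (1 - D) = (r * u) * (B - 1 - v)" by (simp add: mult.assoc)
    then have x: "r * (1 - D) = B - 1 - v" using ru by simp
    have "r * D = r - r * (1 - D)" by (simp add: right_diff_distrib)
    then have y: "r * D = 2 + B + C + t"
      unfolding x using cubic by (simp add: a_real)
    have eq: "r * (1 - D) - of_int (b - 2) = 1 - v" by (simp add: x B_def)
    show "of_int (b - 2) < r * (1 - D)" "r * (1 - D) < of_int (b - 2) + 1"
      "of_int (a - b + 3) \<le> r * D" "r * D < of_int (a - b + 3) + 1"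
      unfolding x y using v_bounds t by (simp_all add: a_real B_def)
    show "t * (r * (1 - D) - of_int (b - 2)) = r * D - of_int (a - b + 3)"
      unfolding eq y using v by (simp add: a_real B_def algebra_simps)
    show "(r + 1) * (r * (1 - D) - of_int (b - 2)) = 1"
      unfolding eq by (rule r_plus_1_mult)
  qed
  ultimately show "iJPA_rel\<^sup>*\<^sup>* (1 / (t + 1), 1 / (t\<^sup>2 - 1)) (t, r + 1)" by auto
qed (use assms in simp)

lemma iJPA_periodic_simplest_cubic:
  assumes "a \<ge> - 1"
  shows "iJPA_periodic (t, t\<^sup>2)"
proof -
  consider "a = - 1" | "a = 0" | "1 \<le> a" "a \<le> 3" | "a \<ge> 4" using assms by linarith
  then show ?thesis
    by cases (simp_all add: iJPA_periodic_minus_one iJPA_periodic_zero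
      iJPA_periodic_1_to_3 iJPA_periodic_ge_4)
qed

end

theorem proposition6p2:
  fixes a :: int and \<rho>' :: real
  assumes "a \<ge> - 1"
    and "poly (shanks_poly a) \<rho>' = 0"
    and "- 2 < \<rho>'" and "\<rho>' < - 1"
  shows "iJPA_periodic (- \<rho>', \<rho>'\<^sup>2)"
proof -
  define t v r where "t = - \<rho>'" and "v = 1 / t" and "r = 1 / (t - 1)"
  have t: "1 < t" "t < 2" using assms by (simp_all add: t_def)
  have "t ^ 3 + of_int a * t\<^sup>2 - (of_int a + 3) * t + 1 = 0"
    using assms(2) by (simp add: shanks_poly_def t_def algebra_simps power2_eq_square power3_eq_cube)
  \<comment> \<open>Multiplying this by \<open>t * (t - 1)\<close> gives back the cubic
    equation.\<close>
  then have "r = of_int a + 1 + t - v"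
    using t by (simp add: r_def v_def field_simps power2_eq_square power3_eq_cube)
  moreover have "t * v = 1" "(t - 1) * r = 1" using t by (simp_all add: v_def r_def)
  ultimately have "iJPA_periodic (t, t\<^sup>2)"
    using iJPA_periodic_simplest_cubic[of t v r a] t assms(1) by blast
  then show ?thesis by (simp add: t_def)
qed

end
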